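(* Let $\Gamma$ be a finite graph. The cographic fan $\mathcal F_\Gamma^\perp$ in $H_1(\Gamma,\mathbb R)$ is equal to $\mathcal N(\operatorname{Vor}_\Gamma)$, the normal fan of the Voronoi polytope $\operatorname{Vor}_\Gamma$.
   Context: Graphs. A finite graph $\Gamma$ consists of finite sets $V(\Gamma)$ (vertices) and $\overset{\rightarrow}{E}(\Gamma)$ (oriented edges), a fixed-point-free involution $\iota$ of $\overset{\rightarrow}{E}(\Gamma)$, and source and target maps $s,t:\overset{\rightarrow}{E}(\Gamma)\to V(\Gamma)$ with $s(\vec e)=t(\iota(\vec e))$ (loops and multiple edges allowed). $E(\Gamma):=\overset{\rightarrow}{E}(\Gamma)/\iota$; the two orientations of an edge $e$ are $\overset{\rightarrow}{e}$ and $\overset{\leftarrow}{e}$. Homology. $\overset{\rightarrow}{C}_1(\Gamma,A)$ is the $A$-module generated by $\overset{\rightarrow}{E}(\Gamma)$ with relations $\overset{\leftarrow}{e}=-\overset{\rightarrow}{e}$; $\partial(\overset{\rightarrow}{e})=t(\overset{\rightarrow}{e})-s(\overset{\rightarrow}{e})$; $H_1(\Gamma,A)=\ker\partial$. The positive definite bilinear form on $\overset{\rightarrow}{C}_1(\Gamma,\mathbb R)$, restricted to $H_1(\Gamma,\mathbb R)$, is determined by $(\overset{\rightarrow}{e},\overset{\rightarrow}{e})=1$, $(\overset{\rightarrow}{e},\overset{\leftarrow}{e})=-1$, $(\overset{\rightarrow}{e},\overset{\rightarrow}{f})=0$ for $f\ne e$. Cographic fan. The cographic arrangement is the set of hyperplanes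 $\{v\in H_1(\Gamma,\mathbb R):(v,e)=0\}$ for those $e\in E(\Gamma)$ with $(\cdot,e)\not\equiv0$ on $H_1(\Gamma,\mathbb R)$. The cographic fan $\mathcal F_\Gamma^\perp$ consists of the closures of the connected components of its complement in $H_1(\Gamma,\mathbb R)$ and all their faces. Voronoi polytope. $\operatorname{Vor}_\Gamma=\{v\in H_1(\Gamma,\mathbb R):(v,v)\le(v-\lambda,v-\lambda)\ \forall\lambda\in H_1(\Gamma,\mathbb Z)\}$. For a non-empty face $\delta$ of $\operatorname{Vor}_\Gamma$ (including $\operatorname{Vor}_\Gamma$ itself), $C_\delta=\{\alpha\in H_1(\Gamma,\mathbb R):(\alpha,r)\ge(\alpha,r')\ \forall r\in\delta,\ r'\in\operatorname{Vor}_\Gamma\}$; the normal fan $\mathcal N(\operatorname{Vor}_\Gamma)$ is the fan whose cones are the $C_\delta$. *)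

theory Defs
  imports "HOL-Analysis.Analysis" "Graph_Theory.Bidirected_Digraph"
begin

text \<open>
  The arcs of \<open>G\<close> are the oriented edges and \<open>arev\<close> is the fixed-point-free involution
  reversing them.  Loops, multiple edges and an empty arc set are allowed, and no connectedness is
  assumed.  The convention of \<^locale>\<open>bidirected_digraph\<close> that \<open>arev\<close> is the identity off
  \<open>arcs G\<close> only fixes irrelevant values.
\<close>

locale finite_graph = fin_digraph G + bidirected_digraph G arev
  for G :: "('v, 'e::finite) pre_digraph" and arev :: "'e \<Rightarrow> 'e"

text \<open>
  The module of 1-chains with coefficients in \<open>'a\<close> (generators the oriented edges, relations
  \<open>arev e = - e\<close>) is realised by its coordinates: a chain is a function on the oriented edges that
  is antisymmetric under \<open>arev\<close>, and the generator \<open>e\<close> is the function with value \<open>1\<close> at \<open>e\<close>,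
  \<open>- 1\<close> at \<open>arev e\<close> and \<open>0\<close> elsewhere.  The lemmas below justify this.  The oriented
  edges form an arbitrary subset of a finite type \<open>'e\<close>, which puts real chains in \<open>real ^ 'e\<close>.
\<close>

definition chains :: "('v, 'e::finite) pre_digraph \<Rightarrow> ('e \<Rightarrow> 'e) \<Rightarrow> ('a::comm_ring_1 ^ 'e) set" where
  "chains G arev =
     {c. (\<forall>e\<in>arcs G. c $ arev e = - c $ e) \<and> (\<forall>e. e \<notin> arcs G \<longrightarrow> c $ e = 0)}"

definition edge_chain :: "('e::finite \<Rightarrow> 'e) \<Rightarrow> 'e \<Rightarrow> 'a::comm_ring_1 ^ 'e" where
  "edge_chain arev e = axis e 1 - axis (arev e) 1"

text \<open>
  Summing the coefficients of the oriented edges with target \<open>v\<close> counts both orientations of every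
  edge, which produces target minus source; see \<open>boundary_edge_chain\<close>.
\<close>

definition boundary :: "('v, 'e::finite) pre_digraph \<Rightarrow> 'a::comm_ring_1 ^ 'e \<Rightarrow> 'v \<Rightarrow> 'a" where
  "boundary G c v = (\<Sum>e\<in>{e \<in> arcs G. head G e = v}. c $ e)"

definition H1 :: "('v, 'e::finite) pre_digraph \<Rightarrow> ('e \<Rightarrow> 'e) \<Rightarrow> ('a::comm_ring_1 ^ 'e) set" where
  "H1 G arev = {c \<in> chains G arev. \<forall>v\<in>verts G. boundary G c v = 0}"

abbreviation H1_real :: "('v, 'e::finite) pre_digraph \<Rightarrow> ('e \<Rightarrow> 'e) \<Rightarrow> (real ^ 'e) set" where
  "H1_real \<equiv> H1"

text \<open>The image of integral homology in real homology.\<close>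

definition H1_lattice :: "('v, 'e::finite) pre_digraph \<Rightarrow> ('e \<Rightarrow> 'e) \<Rightarrow> (real ^ 'e) set" where
  "H1_lattice G arev = (\<lambda>c. \<chi> e. real_of_int (c $ e)) ` (H1 G arev :: (int ^ 'e) set)"

text \<open>
  Every edge contributes two coordinates, hence the factor one half compared with the
  standard inner product; see \<open>chain_form_edge_chain\<close>.
\<close>

definition chain_form :: "real ^ 'e::finite \<Rightarrow> real ^ 'e \<Rightarrow> real" where
  "chain_form c d = (c \<bullet> d) / 2"

context finite_graph
begin

lemma edge_chain_in_chains: "e \<in> arcs G \<Longrightarrow> edge_chain arev e \<in> chains G arev"
  using arev_neq arev_in_arcs[of e]
  by (auto simp: chains_def edge_chain_def axis_def) (metis arev_arev)+

lemma edge_chain_arev: "edge_chain arev (arev e) = - edge_chain arev e"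
  by (simp add: edge_chain_def)

text \<open>
  Choosing one orientation \<open>e \<in> R\<close> of every edge, the chains \<open>edge_chain arev e\<close> form a basis.
\<close>

lemma chain_eq_sum_edge_chain:
  fixes c :: "'a::comm_ring_1 ^ 'e" and a :: "'e \<Rightarrow> 'a"
  assumes R: "R \<subseteq> arcs G" "\<And>e. e \<in> arcs G \<Longrightarrow> e \<in> R \<longleftrightarrow> arev e \<notin> R"
    and c: "c \<in> chains G arev"
  shows "c = (\<Sum>e\<in>R. a e *s edge_chain arev e) \<longleftrightarrow> (\<forall>e\<in>R. a e = c $ e)"
proof -
  have coord: "(\<Sum>e\<in>R. a e *s edge_chain arev e) $ f =
      (if f \<in> R then a f else 0) - (if arev f \<in> R then a (arev f) else 0)" for f
  proof -
    have "(\<Sum>e\<in>R. a e *s edge_chain arev e) $ f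
        = (\<Sum>e\<in>R. (if e = f then a e else 0) - (if e = arev f then a e else 0))"
      unfolding sum_component
      by (rule sum.cong)
        (auto simp: edge_chain_def axis_def)
    then show ?thesis
      by (simp add: sum_subtractf)
  qed
  show ?thesis
  proof
    assume *: "c = (\<Sum>e\<in>R. a e *s edge_chain arev e)"
    show "\<forall>e\<in>R. a e = c $ e"
    proof
      fix e assume "e \<in> R"
      moreover have "arev e \<notin> R" using R \<open>e \<in> R\<close> by blast
      ultimately show "a e = c $ e" using coord[of e] * by simp
    qed
  next
    assume *: "\<forall>e\<in>R. a e = c $ e"
    have "c $ f = (\<Sum>e\<in>R. a e *s edge_chain arev e) $ f" for f
    proof (cases "f \<in> arcs G")
      case True
      then have "c $ arev f = - c $ f" using c by (simp add: chains_def)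
      then show ?thesis using R(2)[OF True] * unfolding coord by auto
    next
      case False
      then have "f \<notin> R" "arev f = f" "c $ f = 0" using R c by (auto simp: arev_eq chains_def)
      then show ?thesis unfolding coord by simp
    qed
    then show "c = (\<Sum>e\<in>R. a e *s edge_chain arev e)" by (simp add: vec_eq_iff)
  qed
qed

lemma boundary_add: "boundary G (c + d) v = boundary G c v + boundary G d v"
  by (simp add: boundary_def sum.distrib)

lemma boundary_scale: "boundary G (r *s c) v = r * boundary G c v"
  by (simp add: boundary_def sum_distrib_left)

lemma boundary_edge_chain:
  assumes "e \<in> arcs G"
  shows "boundary G (edge_chain arev e) v = of_bool (head G e = v) - of_bool (tail G e = v)"
proof -
  let ?I = "{f \<in> arcs G. head G f = v}"
  have fin: "finite ?I" by simp
  have "boundary G (edge_chain arev e) v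
      = (\<Sum>f\<in>?I. (if f = e then 1 else 0) - (if f = arev e then 1 else 0))"
    unfolding boundary_def by (rule sum.cong) (auto simp: edge_chain_def axis_def)
  also have "\<dots> = of_bool (e \<in> ?I) - of_bool (arev e \<in> ?I)"
    using fin by (simp add: sum_subtractf of_bool_def)
  also have "\<dots> = of_bool (head G e = v) - of_bool (tail G e = v)"
    using assms by simp
  finally show ?thesis .
qed

lemma chain_form_edge_chain:
  assumes "e \<in> arcs G" "f \<in> arcs G"
  shows "chain_form (edge_chain arev e) (edge_chain arev f) =
    (if f = e then 1 else if f = arev e then - 1 else 0)"
proof -
  have "arev e \<noteq> e" "arev f \<noteq> f" using assms by (auto simp: arev_neq)
  moreover have "arev e = arev f \<longleftrightarrow> e = f" by (metis arev_arev)
  moreover have "arev f = e \<longleftrightarrow> f = arev e" by (metis arev_arev)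
  ultimately show ?thesis
    by (auto simp: chain_form_def edge_chain_def inner_diff_left inner_diff_right inner_axis_axis)
qed

end

text \<open>The hyperplane of an edge does not depend on the chosen orientation.\<close>

definition cographic_arrangement ::
  "('v, 'e::finite) pre_digraph \<Rightarrow> ('e \<Rightarrow> 'e) \<Rightarrow> (real ^ 'e) set set" where
  "cographic_arrangement G arev =
     {{v \<in> H1_real G arev. chain_form v (edge_chain arev e) = 0} | e.
        e \<in> arcs G \<and> (\<exists>v\<in>H1_real G arev. chain_form v (edge_chain arev e) \<noteq> 0)}"

text \<open>
  Fans are represented by their sets of cones.  The relation \<^const>\<open>face_of\<close> also
  admits the empty set as a face, which is not a cone of a fan and is excluded below.
\<close>

definition cographic_chambers ::
  "('v, 'e::finite) pre_digraph \<Rightarrow> ('e \<Rightarrow> 'e) \<Rightarrow> (real ^ 'e) set set" where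
  "cographic_chambers G arev =
     closure ` components (H1_real G arev - \<Union>(cographic_arrangement G arev))"

definition cographic_fan ::
  "('v, 'e::finite) pre_digraph \<Rightarrow> ('e \<Rightarrow> 'e) \<Rightarrow> (real ^ 'e) set set" where
  "cographic_fan G arev =
     {\<tau>. \<tau> \<noteq> {} \<and> (\<exists>\<sigma>\<in>cographic_chambers G arev. \<tau> face_of \<sigma>)}"

definition Vor :: "('v, 'e::finite) pre_digraph \<Rightarrow> ('e \<Rightarrow> 'e) \<Rightarrow> (real ^ 'e) set" where
  "Vor G arev = {v \<in> H1_real G arev.
     \<forall>l\<in>H1_lattice G arev. chain_form v v \<le> chain_form (v - l) (v - l)}"

definition normal_cone ::
  "('v, 'e::finite) pre_digraph \<Rightarrow> ('e \<Rightarrow> 'e) \<Rightarrow> (real ^ 'e) set \<Rightarrow> (real ^ 'e) set" where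
  "normal_cone G arev \<delta> = {\<alpha> \<in> H1_real G arev.
     \<forall>r\<in>\<delta>. \<forall>r'\<in>Vor G arev. chain_form \<alpha> r \<ge> chain_form \<alpha> r'}"

definition Vor_normal_fan ::
  "('v, 'e::finite) pre_digraph \<Rightarrow> ('e \<Rightarrow> 'e) \<Rightarrow> (real ^ 'e) set set" where
  "Vor_normal_fan G arev = {normal_cone G arev \<delta> | \<delta>. \<delta> \<noteq> {} \<and> \<delta> face_of Vor G arev}"

end

theory Submission
  imports Defs
begin

text \<open>
  Both fans consist of the sign cones of \<open>H = H1\<close>: for \<open>a \<in> H\<close>, the set of all \<open>b \<in> H\<close> whose
  coordinates vanish or have the sign of the corresponding coordinate of \<open>a\<close>.  For the cographic
  fan this is the usual description of the faces of an arrangement.  For the Voronoi polytope the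
  point is that its support function is proportional to the sum of the absolute values of the
  coordinates, which is additive exactly along common sign cones.  The support function is found by
  decomposing a homology class conformally, that is without cancellation, into circuits with
  coordinates in \<open>{- 1, 0, 1}\<close>.
\<close>

section \<open>Sign cones\<close>

text \<open>Where \<open>a $ i\<close> vanishes, the disjunction leaves only
  \<open>b $ i = 0\<close>. For a subspace \<open>H\<close> this is the closed cone of the
  arrangement of coordinate hyperplanes that has \<open>a\<close> in its relative interior.\<close>

definition sign_cone :: "(real ^ 'n) set \<Rightarrow> real ^ 'n \<Rightarrow> (real ^ 'n) set" where
  "sign_cone H a = {b \<in> H. \<forall>i. b $ i = 0 \<or> sgn (b $ i) = sgn (a $ i)}"

text \<open>Coordinates that vanish identically on \<open>H\<close> define no hyperplane of
  \<open>H\<close> and are exempt, as in the cographic arrangement.\<close>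

definition generic_points :: "(real ^ 'n) set \<Rightarrow> (real ^ 'n) set" where
  "generic_points H = {v \<in> H. \<forall>i. (\<exists>w\<in>H. w $ i \<noteq> 0) \<longrightarrow> v $ i \<noteq> 0}"

lemma sgn_mult_eq_abs_iff: "sgn a * b = \<bar>b\<bar> \<longleftrightarrow> b = 0 \<or> sgn b = sgn a" for a b :: real
  by (auto simp: sgn_if abs_if)

text \<open>This form consists of linear inequalities and equations in \<open>b\<close>, from which
  convexity and closedness can be read off.\<close>

lemma mem_sign_cone_iff:
  "b \<in> sign_cone H a \<longleftrightarrow> b \<in> H \<and> (\<forall>i. 0 \<le> sgn (a $ i) * b $ i \<and> (a $ i = 0 \<longrightarrow> b $ i = 0))"
proof -
  have "(y = 0 \<or> sgn y = sgn x) \<longleftrightarrow> (0 \<le> sgn x * y \<and> (x = 0 \<longrightarrow> y = 0))" for x y :: real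
    by (auto simp: sgn_if)
  then show ?thesis by (simp add: sign_cone_def)
qed

lemma sign_cone_self: "a \<in> H \<Longrightarrow> a \<in> sign_cone H a"
  by (simp add: sign_cone_def)

lemma sign_cone_subset: "sign_cone H a \<subseteq> H"
  by (auto simp: sign_cone_def)

lemma sign_cone_mono:
  assumes "b \<in> sign_cone H a"
  shows "sign_cone H b \<subseteq> sign_cone H a"
proof
  fix c assume "c \<in> sign_cone H b"
  then show "c \<in> sign_cone H a"
    using assms unfolding sign_cone_def by (auto, metis sgn_0_0)
qed

lemma sign_cone_scale:
  assumes "subspace H" "b \<in> sign_cone H a" "0 \<le> t"
  shows "t *\<^sub>R b \<in> sign_cone H a"
  using assms by (auto simp: sign_cone_def subspace_scale sgn_mult)

lemma convex_sign_cone: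
  assumes "subspace H"
  shows "convex (sign_cone H a)"
proof (rule convexI)
  fix x y and u v :: real
  assume *: "x \<in> sign_cone H a" "y \<in> sign_cone H a" "0 \<le> u" "0 \<le> v" "u + v = 1"
  have "sgn (a $ i) * (u * x $ i + v * y $ i) = u * (sgn (a $ i) * x $ i) + v * (sgn (a $ i) * y $ i)" for i
    by (simp add: algebra_simps)
  then show "u *\<^sub>R x + v *\<^sub>R y \<in> sign_cone H a"
    using * assms by (auto simp: mem_sign_cone_iff subspace_add subspace_scale)
qed

lemma closed_sign_cone:
  fixes H :: "(real ^ 'n) set"
  assumes "subspace H"
  shows "closed (sign_cone H a)"
proof -
  have "sign_cone H a = H \<inter> (\<Inter>i. {b. 0 \<le> sgn (a $ i) * b $ i} \<inter> {b. a $ i = 0 \<longrightarrow> b $ i = 0})"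
    by (auto simp: mem_sign_cone_iff)
  moreover have "closed {b :: real ^ 'n. a $ i = 0 \<longrightarrow> b $ i = 0}" for i
    by (cases "a $ i = 0") (auto intro!: closed_Collect_eq continuous_intros)
  moreover have "closed {b :: real ^ 'n. 0 \<le> sgn (a $ i) * b $ i}" for i
    by (intro closed_Collect_le continuous_intros)
  ultimately show ?thesis
    using assms by (auto intro!: closed_Int closed_INT simp: closed_subspace)
qed

text \<open>Each nonzero coordinate keeps its sign near \<open>t = 0\<close> by continuity, and
  there are only finitely many coordinates. The bound \<open>t < 1\<close> later permits division by
  \<open>1 - t\<close>.\<close>

lemma sgn_perturb:
  fixes a b :: "real ^ 'n"
  obtains t where "0 < t" "t < 1" "\<And>i. a $ i \<noteq> 0 \<Longrightarrow> sgn (a $ i + t * b $ i) = sgn (a $ i)"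
proof -
  have "\<forall>\<^sub>F t in at_right 0. a $ i \<noteq> 0 \<longrightarrow> sgn (a $ i + t * b $ i) = sgn (a $ i)" for i
  proof -
    have lim: "((\<lambda>t. a $ i + t * b $ i) \<longlongrightarrow> a $ i) (at_right 0)"
      by (auto intro!: tendsto_eq_intros)
    consider "a $ i = 0" | "a $ i > 0" | "a $ i < 0" by linarith
    then show ?thesis
    proof cases
      case 2
      then show ?thesis using order_tendstoD(1)[OF lim 2] by (auto elim: eventually_mono)
    next
      case 3
      then show ?thesis using order_tendstoD(2)[OF lim 3] by (auto elim: eventually_mono)
    qed auto
  qed
  then have "\<forall>\<^sub>F t in at_right 0. \<forall>i. a $ i \<noteq> 0 \<longrightarrow> sgn (a $ i + t * b $ i) = sgn (a $ i)"
    by (rule eventually_all_finite)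
  moreover have "\<forall>\<^sub>F t in at_right 0. 0 < t \<and> t < (1::real)"
    using eventually_at_right_real[of 0 1] by auto
  ultimately have "\<forall>\<^sub>F t in at_right 0. (0 < t \<and> t < 1) \<and>
      (\<forall>i. a $ i \<noteq> 0 \<longrightarrow> sgn (a $ i + t * b $ i) = sgn (a $ i))"
    by (rule eventually_conj[rotated])
  then obtain t where "0 < t" "t < 1" "\<forall>i. a $ i \<noteq> 0 \<longrightarrow> sgn (a $ i + t * b $ i) = sgn (a $ i)"
    using eventually_happens[of _ "at_right (0::real)"] by (auto simp: trivial_limit_at_right_real)
  then show ?thesis using that by blast
qed

text \<open>This expresses that \<open>a\<close> is relatively interior to its cone: for every
  \<open>b\<close> in the cone, \<open>a\<close> is a sum of a positive multiple of \<open>b\<close>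
  and another element of the cone.\<close>

lemma sign_cone_subtract:
  assumes H: "subspace H" and a: "a \<in> H" and b: "b \<in> sign_cone H a"
  obtains t where "0 < t" "t < 1" "a - t *\<^sub>R b \<in> sign_cone H a"
proof -
  obtain t where t: "0 < t" "t < 1" "\<And>i. a $ i \<noteq> 0 \<Longrightarrow> sgn (a $ i + t * (- b) $ i) = sgn (a $ i)"
    using sgn_perturb[where a = a and b = "- b"] by blast
  have "a - t *\<^sub>R b \<in> H"
    using H a b sign_cone_subset[of H a] by (auto intro!: subspace_diff subspace_scale)
  moreover have "b $ i = 0" if "a $ i = 0" for i
    using b that by (auto simp: mem_sign_cone_iff)
  ultimately have "a - t *\<^sub>R b \<in> sign_cone H a"
    using t(3) by (force simp: sign_cone_def)
  then show ?thesis using that t by blast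
qed

text \<open>On one sign cone the sum of absolute values agrees with a linear functional, whose
  coefficients are the signs of \<open>a\<close>.\<close>

lemma sum_abs_sign_cone:
  assumes "b \<in> sign_cone H a" "c \<in> sign_cone H a" "d \<in> sign_cone H a" "b = c + t *\<^sub>R d"
  shows "(\<Sum>i\<in>UNIV. \<bar>b $ i\<bar>) = (\<Sum>i\<in>UNIV. \<bar>c $ i\<bar>) + t * (\<Sum>i\<in>UNIV. \<bar>d $ i\<bar>)"
proof -
  have eq: "\<bar>x $ i\<bar> = sgn (a $ i) * x $ i" if "x \<in> sign_cone H a" for x i
    using that sgn_mult_eq_abs_iff[of "a $ i" "x $ i"] by (auto simp: sign_cone_def)
  show ?thesis
    unfolding eq[OF assms(1)] eq[OF assms(2)] eq[OF assms(3)]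
    by (simp add: assms(4) algebra_simps sum.distrib sum_distrib_left)
qed

section \<open>Faces of sign cones\<close>

lemma sign_cone_face_of:
  fixes H :: "(real ^ 'n) set"
  assumes H: "subspace H" and b: "b \<in> sign_cone H a"
  shows "sign_cone H b face_of sign_cone H a"
proof -
  \<comment> \<open>Inside the larger cone the signs are already prescribed, so only the vanishing
    conditions of \<open>b\<close> remain.\<close>
  have eq: "sign_cone H b = {c \<in> sign_cone H a. \<forall>i. b $ i = 0 \<longrightarrow> c $ i = 0}"
  proof (intro set_eqI iffI)
    fix c assume "c \<in> sign_cone H b"
    then show "c \<in> {c \<in> sign_cone H a. \<forall>i. b $ i = 0 \<longrightarrow> c $ i = 0}"
      using sign_cone_mono[OF b] mem_sign_cone_iff[of c H b] by auto
  next
    fix c assume "c \<in> {c \<in> sign_cone H a. \<forall>i. b $ i = 0 \<longrightarrow> c $ i = 0}"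
    then show "c \<in> sign_cone H b"
      using b unfolding sign_cone_def by (smt (verit) mem_Collect_eq)
  qed
  show ?thesis unfolding face_of_def
  proof (intro conjI ballI impI)
    show "sign_cone H b \<subseteq> sign_cone H a" by (rule sign_cone_mono[OF b])
    show "convex (sign_cone H b)" by (rule convex_sign_cone[OF H])
    fix x y z
    assume x: "x \<in> sign_cone H a" and y: "y \<in> sign_cone H a" and z: "z \<in> sign_cone H b"
      and "z \<in> open_segment x y"
    then obtain u where u: "0 < u" "u < 1" "z = (1 - u) *\<^sub>R x + u *\<^sub>R y"
      by (auto simp: in_segment)
    \<comment> \<open>Up to the sign of \<open>a $ i\<close> this coordinate is nonnegative on the
      larger cone, so a combination with positive weights vanishes only if both endpoints
      do.\<close>
    have "x $ i = 0 \<and> y $ i = 0" if "b $ i = 0" for i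
    proof (cases "a $ i = 0")
      case True then show ?thesis using x y by (auto simp: mem_sign_cone_iff)
    next
      case False
      have "z $ i = 0" using z that by (auto simp: mem_sign_cone_iff)
      then have "(1 - u) * (sgn (a $ i) * x $ i) + u * (sgn (a $ i) * y $ i) = 0"
      proof -
        have "(1 - u) * (sgn (a $ i) * x $ i) + u * (sgn (a $ i) * y $ i) = sgn (a $ i) * z $ i"
          by (simp add: u(3) algebra_simps)
        then show ?thesis using \<open>z $ i = 0\<close> by simp
      qed
      moreover have "0 \<le> sgn (a $ i) * x $ i" "0 \<le> sgn (a $ i) * y $ i"
        using x y by (auto simp: mem_sign_cone_iff)
      ultimately have "(1 - u) * (sgn (a $ i) * x $ i) = 0" "u * (sgn (a $ i) * y $ i) = 0"
        using u by (smt (verit) mult_nonneg_nonneg)+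
      then show ?thesis using u False by (auto simp: sgn_0_0)
    qed
    then show "x \<in> sign_cone H b" "y \<in> sign_cone H b"
      using x y unfolding eq by auto
  qed
qed

text \<open>Take \<open>b\<close> in the relative interior of the face. A segment from a point
  \<open>c\<close> of the face to \<open>b\<close> can be prolonged beyond \<open>b\<close> inside
  the face; a coordinate of \<open>c\<close> at which \<open>b\<close> vanishes would change sign
  there, so it is zero. Conversely, each other point of the cone of \<open>b\<close> is an endpoint
  of an open segment through \<open>b\<close> within the large cone, so the face property puts it
  into the face.\<close>

lemma face_of_sign_cone:
  fixes H :: "(real ^ 'n) set"
  assumes H: "subspace H" and T: "T face_of sign_cone H a" "T \<noteq> {}"
  obtains b where "b \<in> H" "T = sign_cone H b"
proof -
  have conv: "convex T" and sub: "T \<subseteq> sign_cone H a"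
    using T face_of_imp_convex face_of_imp_subset by blast+
  obtain b where b: "b \<in> rel_interior T"
    using T rel_interior_eq_empty[OF conv] by auto
  then have bT: "b \<in> T" using rel_interior_subset by blast
  have ba: "b \<in> sign_cone H a" using bT sub by blast
  then have bH: "b \<in> H" using sign_cone_subset by blast
  have "T = sign_cone H b"
  proof (intro set_eqI iffI)
    fix c assume c: "c \<in> T"
    then obtain e where e: "e > 1" "(1 - e) *\<^sub>R c + e *\<^sub>R b \<in> T"
      using convex_rel_interior_iff[OF conv T(2)] b by blast
    have ca: "c \<in> sign_cone H a" and da: "(1 - e) *\<^sub>R c + e *\<^sub>R b \<in> sign_cone H a"
      using c e sub by auto
    have "c $ i = 0" if "b $ i = 0" for i
    proof (cases "a $ i = 0")
      case True then show ?thesis using ca by (auto simp: mem_sign_cone_iff)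
    next
      case False
      have "0 \<le> sgn (a $ i) * c $ i" using ca by (auto simp: mem_sign_cone_iff)
      moreover have "0 \<le> sgn (a $ i) * ((1 - e) * c $ i)"
        using da that unfolding mem_sign_cone_iff by (metis add_0_right mult_zero_right
            real_scaleR_def vector_add_component vector_scaleR_component)
      then have "(e - 1) * (sgn (a $ i) * c $ i) \<le> 0" by (simp add: algebra_simps)
      ultimately have "sgn (a $ i) * c $ i = 0" using e(1) by (smt (verit) mult_pos_pos)
      then show ?thesis using False by (auto simp: sgn_0_0)
    qed
    then show "c \<in> sign_cone H b"
      using ca ba unfolding sign_cone_def by (smt (verit) mem_Collect_eq)
  next
    fix c assume c: "c \<in> sign_cone H b"
    show "c \<in> T"
    proof (cases "c = b")
      case True then show ?thesis using bT by simp
    next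
      case False
      obtain t where t: "0 < t" "t < 1" "b - t *\<^sub>R c \<in> sign_cone H b"
        using sign_cone_subtract[OF H bH c] by blast
      \<comment> \<open>The rescaling makes \<open>b\<close> a convex combination of
        \<open>d\<close> and \<open>c\<close> with weights \<open>1 - t\<close> and
        \<open>t\<close>.\<close>
      define d where "d = (1 / (1 - t)) *\<^sub>R (b - t *\<^sub>R c)"
      have "d \<in> sign_cone H b" unfolding d_def using t by (intro sign_cone_scale[OF H]) auto
      then have d: "d \<in> sign_cone H a" using sign_cone_mono[OF ba] by blast
      have bd: "b = (1 - t) *\<^sub>R d + t *\<^sub>R c" using t by (simp add: d_def)
      have "d \<noteq> c"
      proof
        assume "d = c"
        then have "b = c" using bd by (simp flip: scaleR_left_distrib)
        then show False using False by simp
      qed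
      then have "b \<in> open_segment d c"
        using bd t by (auto simp: in_segment)
      then show ?thesis
        using face_ofD[OF T(1) _ d _ bT] c sign_cone_mono[OF ba] by blast
    qed
  qed
  then show ?thesis using that bH by blast
qed

section \<open>Chambers of the coordinate arrangement\<close>

lemma generic_sign_cone:
  fixes H :: "(real ^ 'n) set"
  assumes H: "subspace H" and a: "a \<in> H"
  obtains u where "u \<in> generic_points H" "a \<in> sign_cone H u"
proof -
  \<comment> \<open>The witness is an element of \<open>A\<close> with the largest support. If it
    vanished in a coordinate that is nonzero at some \<open>w\<close> in \<open>H\<close>, adding a
    small multiple of \<open>w\<close> would enlarge the support without leaving
    \<open>A\<close>.\<close>
  define A where "A = {u \<in> H. a \<in> sign_cone H u}"
  define f where "f u = card {i. u $ i \<noteq> 0}" for u :: "real ^ 'n"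
  have "a \<in> A" using a by (simp add: A_def sign_cone_self)
  moreover have "f u < Suc CARD('n)" for u unfolding f_def by (simp add: less_Suc_eq_le card_mono)
  ultimately have "\<exists>u. u \<in> A \<and> (\<forall>w. w \<in> A \<longrightarrow> f w \<le> f u)"
    by (intro ex_has_greatest_nat[where k = a and b = "Suc CARD('n)"]) auto
  then obtain u where u: "u \<in> A" "\<And>w. w \<in> A \<Longrightarrow> f w \<le> f u" by blast
  have uH: "u \<in> H" using u by (simp add: A_def)
  have "u $ i \<noteq> 0" if "w \<in> H" "w $ i \<noteq> 0" for w i
  proof
    assume 0: "u $ i = 0"
    obtain t where t: "0 < t" "\<And>i. u $ i \<noteq> 0 \<Longrightarrow> sgn (u $ i + t * w $ i) = sgn (u $ i)"
      using sgn_perturb[of u w] by blast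
    let ?v = "u + t *\<^sub>R w"
    have vH: "?v \<in> H" using uH that H by (simp add: subspace_add subspace_scale)
    have sg: "sgn (?v $ i) = sgn (u $ i)" if "u $ i \<noteq> 0" for i using t(2)[OF that] by simp
    have "u $ i = 0 \<or> sgn (u $ i) = sgn (?v $ i)" for i using sg[of i] by metis
    then have "u \<in> sign_cone H ?v" using uH unfolding sign_cone_def by blast
    then have "?v \<in> A" using u vH sign_cone_mono unfolding A_def by blast
    moreover have "{i. u $ i \<noteq> 0} \<subset> {i. ?v $ i \<noteq> 0}"
    proof
      show "{i. u $ i \<noteq> 0} \<subseteq> {i. ?v $ i \<noteq> 0}"
      proof
        fix i assume "i \<in> {i. u $ i \<noteq> 0}"
        then have "sgn (?v $ i) \<noteq> 0" using sg[of i] by (simp add: sgn_0_0)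
        then show "i \<in> {i. ?v $ i \<noteq> 0}" by (simp add: sgn_0_0)
      qed
      show "{i. u $ i \<noteq> 0} \<noteq> {i. ?v $ i \<noteq> 0}"
      proof
        assume "{i. u $ i \<noteq> 0} = {i. ?v $ i \<noteq> 0}"
        moreover have "?v $ i \<noteq> 0" using 0 t(1) \<open>w $ i \<noteq> 0\<close> by simp
        ultimately show False using 0 by blast
      qed
    qed
    then have "f u < f ?v" unfolding f_def by (intro psubset_card_mono) auto
    ultimately show False using u(2) by fastforce
  qed
  then have "u \<in> generic_points H" using uH by (auto simp: generic_points_def)
  then show ?thesis using that u by (auto simp: A_def)
qed

text \<open>A coordinate that is not identically zero on \<open>H\<close> has no zero among the
  generic points, so by the intermediate value theorem its sign is constant on a component.
  Conversely, the vectors of \<open>H\<close> with prescribed signs form a convex, hence connected,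
  set.\<close>

lemma connected_component_generic_points:
  fixes H :: "(real ^ 'n) set"
  assumes H: "subspace H" and u: "u \<in> generic_points H"
  shows "connected_component_set (generic_points H) u = {b \<in> H. \<forall>i. sgn (b $ i) = sgn (u $ i)}"
    (is "?C = ?O")
proof
  show "?C \<subseteq> ?O"
  proof
    fix b assume b: "b \<in> ?C"
    have sub: "?C \<subseteq> generic_points H" by (rule connected_component_subset)
    have conn: "connected ?C" by (rule connected_connected_component)
    have uC: "u \<in> ?C" using u by (simp add: connected_component_refl_eq)
    have bH: "b \<in> H" and uH: "u \<in> H" using b sub u by (auto simp: generic_points_def)
    have "sgn (b $ i) = sgn (u $ i)" for i
    proof (cases "\<exists>w\<in>H. w $ i \<noteq> 0")
      case True
      then have nz: "z $ i \<noteq> 0" if "z \<in> ?C" for z using that sub by (auto simp: generic_points_def)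
      show ?thesis
      proof (rule ccontr)
        assume "sgn (b $ i) \<noteq> sgn (u $ i)"
        then have "b $ i \<le> 0 \<and> 0 \<le> u $ i \<or> u $ i \<le> 0 \<and> 0 \<le> b $ i"
          by (auto simp: sgn_if split: if_splits)
        then show False
          using connected_ivt_component_cart[OF conn b uC] connected_ivt_component_cart[OF conn uC b] nz
          by metis
      qed
    next
      case False then show ?thesis using bH uH by auto
    qed
    then show "b \<in> ?O" using bH by simp
  qed
  have "convex ?O"
  proof (rule convexI)
    fix x y and s t :: real
    assume *: "x \<in> ?O" "y \<in> ?O" "0 \<le> s" "0 \<le> t" "s + t = 1"
    have "sgn (s * x $ i + t * y $ i) = sgn (u $ i)" for i
    proof -
      have eq: "sgn (x $ i) = sgn (u $ i)" "sgn (y $ i) = sgn (u $ i)" using * by auto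
      consider "s = 0" "t = 1" | "s > 0" using * by linarith
      then show ?thesis
      proof cases
        case 2
        consider "u $ i = 0" | "u $ i > 0" | "u $ i < 0" by linarith
        then show ?thesis
        proof cases
          case 1
          then show ?thesis using eq by (simp add: sgn_0_0)
        next
          case 2
          then have "x $ i > 0" "y $ i > 0" using eq by (auto simp: sgn_1_pos)
          then have "s * x $ i + t * y $ i > 0"
            using \<open>s > 0\<close> * by (simp add: add_pos_nonneg)
          then show ?thesis using 2 by simp
        next
          case 3
          then have "x $ i < 0" "y $ i < 0" using eq by (auto simp: sgn_1_neg)
          then have "s * x $ i + t * y $ i < 0"
            using \<open>s > 0\<close> * by (simp add: add_neg_nonpos mult_pos_neg mult_nonneg_nonpos)
          then show ?thesis using 3 by simp
        qed
      qed (use eq in simp)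
    qed
    then show "s *\<^sub>R x + t *\<^sub>R y \<in> ?O"
      using * H by (simp add: subspace_add subspace_scale)
  qed
  moreover have "?O \<subseteq> generic_points H"
    using u by (auto simp: generic_points_def) (metis sgn_0_0)
  ultimately show "?O \<subseteq> ?C"
    using u by (intro connected_component_maximal convex_connected) (auto simp: generic_points_def)
qed

lemma closure_open_sign_cone:
  fixes H :: "(real ^ 'n) set"
  assumes H: "subspace H" and u: "u \<in> H"
  shows "closure {b \<in> H. \<forall>i. sgn (b $ i) = sgn (u $ i)} = sign_cone H u" (is "closure ?O = _")
proof
  show "closure ?O \<subseteq> sign_cone H u"
    by (rule closure_minimal[OF _ closed_sign_cone[OF H]]) (auto simp: sign_cone_def)
  show "sign_cone H u \<subseteq> closure ?O"
  proof
    fix b assume b: "b \<in> sign_cone H u"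
    \<comment> \<open>Adding a small positive multiple of \<open>u\<close> gives the vanishing
      coordinates of \<open>b\<close> the signs of \<open>u\<close> and leaves the other signs
      unchanged.\<close>
    let ?x = "\<lambda>n. b + inverse (real (Suc n)) *\<^sub>R u"
    have "?x n \<in> ?O" for n
    proof -
      have "sgn (b $ i + inverse (real (Suc n)) * u $ i) = sgn (u $ i)" for i
      proof -
        have p: "inverse (real (Suc n)) > 0" by simp
        have "b $ i = 0 \<or> sgn (b $ i) = sgn (u $ i)" using b by (auto simp: sign_cone_def)
        then show ?thesis
        proof
          assume "b $ i = 0" then show ?thesis by (simp add: sgn_mult)
        next
          assume s: "sgn (b $ i) = sgn (u $ i)"
          consider "u $ i = 0" | "u $ i > 0" | "u $ i < 0" by linarith
          then show ?thesis
          proof cases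
            case 1 then show ?thesis using s by (simp add: sgn_0_0)
          next
            case 2
            then have "b $ i > 0" using s by (auto simp: sgn_1_pos)
            then have "b $ i + inverse (real (Suc n)) * u $ i > 0"
              using 2 p by (intro add_pos_pos mult_pos_pos)
            then show ?thesis using 2 by simp
          next
            case 3
            then have "b $ i < 0" using s by (auto simp: sgn_1_neg)
            then have "b $ i + inverse (real (Suc n)) * u $ i < 0"
              using 3 p by (intro add_neg_neg mult_pos_neg)
            then show ?thesis using 3 by simp
          qed
        qed
      qed
      moreover have "?x n \<in> H"
        using H b u sign_cone_subset[of H u] by (auto intro!: subspace_add subspace_scale)
      ultimately show ?thesis by simp
    qed
    moreover have "?x \<longlonglongrightarrow> b + 0 *\<^sub>R u"
      by (intro tendsto_intros LIMSEQ_inverse_real_of_nat)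
    ultimately show "b \<in> closure ?O"
      unfolding closure_sequential by (intro exI[of _ ?x]) auto
  qed
qed

text \<open>The closed chambers are the sign cones of generic points. Their nonempty faces are again
  sign cones, and each sign cone arises because its defining point lies in the cone of some generic
  point.\<close>

lemma faces_generic_chambers:
  fixes H :: "(real ^ 'n) set"
  assumes H: "subspace H"
  shows "{\<tau>. \<tau> \<noteq> {} \<and> (\<exists>\<sigma>\<in>closure ` components (generic_points H). \<tau> face_of \<sigma>)} = sign_cone H ` H"
proof -
  have "closure ` components (generic_points H) = sign_cone H ` generic_points H"
    unfolding components_def image_image
    using connected_component_generic_points[OF H] closure_open_sign_cone[OF H]
    by (intro image_cong refl) (simp add: generic_points_def[of H])
  moreover have "\<tau> \<noteq> {} \<and> (\<exists>u\<in>generic_points H. \<tau> face_of sign_cone H u) \<longleftrightarrow> \<tau> \<in> sign_cone H ` H" for \<tau>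
  proof
    assume "\<tau> \<noteq> {} \<and> (\<exists>u\<in>generic_points H. \<tau> face_of sign_cone H u)"
    then show "\<tau> \<in> sign_cone H ` H" using face_of_sign_cone[OF H] by (metis imageI)
  next
    assume "\<tau> \<in> sign_cone H ` H"
    then obtain a where a: "a \<in> H" "\<tau> = sign_cone H a" by blast
    obtain u where "u \<in> generic_points H" "a \<in> sign_cone H u"
      using generic_sign_cone[OF H a(1)] by blast
    then show "\<tau> \<noteq> {} \<and> (\<exists>u\<in>generic_points H. \<tau> face_of sign_cone H u)"
      using a sign_cone_self[of a H] sign_cone_face_of[OF H] by blast
  qed
  ultimately show ?thesis by auto
qed

section \<open>The Voronoi polytope of a regular lattice\<close>

text \<open>This isolates what the graph contributes. The last assumption is the regularity
  (unimodularity) of the lattice: beneath every nonzero vector of \<open>H\<close> lies a conformal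
  lattice vector with coordinates in {-1, 0, 1}.\<close>

locale regular_lattice =
  fixes H L :: "(real ^ 'n) set"
  assumes subspace: "subspace H"
    and lattice_subset: "L \<subseteq> H"
    and lattice_int: "l \<in> L \<Longrightarrow> l $ i \<in> \<int>"
    and conformal_circuit: "a \<in> H \<Longrightarrow> a \<noteq> 0 \<Longrightarrow>
      \<exists>l\<in>L. l \<in> sign_cone H a \<and> l \<noteq> 0 \<and> (\<forall>i. l $ i \<in> {- 1, 0, 1})"
begin

text \<open>This is the Voronoi inequality after expanding the square. A positive factor in the form
  cancels, so the standard inner product serves here.\<close>

definition voronoi :: "(real ^ 'n) set" where
  "voronoi = {v \<in> H. \<forall>l\<in>L. 2 * (v \<bullet> l) \<le> l \<bullet> l}"

text \<open>Minimality of the support is not demanded, so this set may exceed the circuits in the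
  sense of matroid theory; it is still finite.\<close>

definition circuits :: "(real ^ 'n) set" where
  "circuits = {l \<in> L. \<forall>i. l $ i \<in> {- 1, 0, 1}}"

definition normal :: "(real ^ 'n) set \<Rightarrow> (real ^ 'n) set" where
  "normal \<delta> = {a \<in> H. \<forall>r\<in>\<delta>. \<forall>r'\<in>voronoi. a \<bullet> r' \<le> a \<bullet> r}"

lemma finite_circuits: "finite circuits"
proof -
  have "vec_nth ` circuits \<subseteq> PiE UNIV (\<lambda>_. {- 1, 0, 1})"
    by (auto simp: circuits_def)
  then have "finite (vec_nth ` circuits)"
    by (rule finite_subset) (intro finite_PiE; simp)
  then show ?thesis
    by (rule finite_imageD) (auto simp: inj_on_def vec_eq_iff)
qed

text \<open>
  Subtracting a conformal circuit with the largest admissible coefficient shrinks the support, and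
  the sum of absolute values is additive along the way.
\<close>

lemma circuit_bound:
  assumes v: "\<And>l. l \<in> circuits \<Longrightarrow> 2 * (v \<bullet> l) \<le> l \<bullet> l" and "a \<in> H"
  shows "2 * (v \<bullet> a) \<le> (\<Sum>i\<in>UNIV. \<bar>a $ i\<bar>)"
  using \<open>a \<in> H\<close>
proof (induction "card {i. a $ i \<noteq> 0}" arbitrary: a rule: less_induct)
  case less
  show ?case
  proof (cases "a = 0")
    case False
    then obtain l where l: "l \<in> L" "l \<in> sign_cone H a" "l \<noteq> 0" "\<And>i. l $ i \<in> {- 1, 0, 1}"
      using conformal_circuit[OF less.prems] by blast
    let ?S = "{i. l $ i \<noteq> 0}"
    have "?S \<noteq> {}" using l(3) by (auto simp: vec_eq_iff)
    define t where "t = Min ((\<lambda>i. \<bar>a $ i\<bar>) ` ?S)"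
    have "t \<in> (\<lambda>i. \<bar>a $ i\<bar>) ` ?S" unfolding t_def using \<open>?S \<noteq> {}\<close> by (intro Min_in) auto
    then obtain j where j: "l $ j \<noteq> 0" "t = \<bar>a $ j\<bar>" by auto
    have tle: "t \<le> \<bar>a $ i\<bar>" if "l $ i \<noteq> 0" for i
      unfolding t_def using that by (intro Min_le) auto
    have ls: "l $ i = 0 \<or> l $ i = sgn (a $ i)" "a $ i = 0 \<Longrightarrow> l $ i = 0" for i
    proof -
      have "l $ i = 0 \<or> sgn (l $ i) = sgn (a $ i)" using l(2) by (simp add: sign_cone_def)
      moreover have "sgn (l $ i) = l $ i" using l(4)[of i] by auto
      ultimately show "l $ i = 0 \<or> l $ i = sgn (a $ i)" by simp
      then show "l $ i = 0" if "a $ i = 0" using that by simp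
    qed
    let ?b = "a - t *\<^sub>R l"
    \<comment> \<open>On its support \<open>l\<close> equals the sign of \<open>a\<close>, so the
      subtraction lowers each absolute value there by exactly \<open>t\<close>.\<close>
    have bi: "?b $ i = (if l $ i = 0 then a $ i else sgn (a $ i) * (\<bar>a $ i\<bar> - t))" for i
      using ls(1)[of i] by (auto simp: sgn_if abs_if)
    have bH: "?b \<in> H"
      using less.prems l(1) lattice_subset subspace by (auto intro!: subspace_diff subspace_scale)
    have bs: "?b \<in> sign_cone H a"
      unfolding mem_sign_cone_iff
    proof (intro conjI allI impI bH)
      fix i
      show "0 \<le> sgn (a $ i) * ?b $ i"
        unfolding bi using tle[of i] by (auto simp: sgn_if)
      show "?b $ i = 0" if "a $ i = 0"
        unfolding bi using that by auto
    qed
    have "j \<in> {i. a $ i \<noteq> 0}" "j \<notin> {i. ?b $ i \<noteq> 0}" using j ls(2)[of j] bi[of j] by auto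
    moreover have "{i. ?b $ i \<noteq> 0} \<subseteq> {i. a $ i \<noteq> 0}" using bs by (auto simp: mem_sign_cone_iff)
    ultimately have "card {i. ?b $ i \<noteq> 0} < card {i. a $ i \<noteq> 0}"
      by (intro psubset_card_mono) auto
    then have IH: "2 * (v \<bullet> ?b) \<le> (\<Sum>i\<in>UNIV. \<bar>?b $ i\<bar>)" using less.hyps bH by blast
    \<comment> \<open>For coordinates in {-1, 0, 1} squares and absolute values coincide, which
      turns the quadratic Voronoi bound into a bound by the sum of absolute values.\<close>
    have "l $ i * l $ i = \<bar>l $ i\<bar>" for i using l(4)[of i] by auto
    then have ll: "l \<bullet> l = (\<Sum>i\<in>UNIV. \<bar>l $ i\<bar>)" by (simp add: inner_vec_def)
    have "2 * (v \<bullet> l) \<le> l \<bullet> l" using v l(1,4) by (simp add: circuits_def)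
    then have "t * (2 * (v \<bullet> l)) \<le> t * (\<Sum>i\<in>UNIV. \<bar>l $ i\<bar>)"
      using j(2) ll by (intro mult_left_mono) auto
    moreover have "(\<Sum>i\<in>UNIV. \<bar>a $ i\<bar>) = (\<Sum>i\<in>UNIV. \<bar>?b $ i\<bar>) + t * (\<Sum>i\<in>UNIV. \<bar>l $ i\<bar>)"
      using sum_abs_sign_cone[OF sign_cone_self[OF less.prems] bs l(2), of t] by simp
    ultimately show ?thesis using IH by (simp add: inner_diff_right)
  qed simp
qed

text \<open>The circuit inequalities bound \<open>2 * (v \<bullet> l)\<close> by the sum of absolute
  values of \<open>l\<close>. For integral coordinates this is at most the sum of squares, since an
  integer satisfies |k| <= k * k.\<close>

lemma voronoi_eq_circuits: "voronoi = {v \<in> H. \<forall>l\<in>circuits. 2 * (v \<bullet> l) \<le> l \<bullet> l}"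
proof (intro set_eqI iffI)
  fix v assume v: "v \<in> {v \<in> H. \<forall>l\<in>circuits. 2 * (v \<bullet> l) \<le> l \<bullet> l}"
  have "2 * (v \<bullet> l) \<le> l \<bullet> l" if l: "l \<in> L" for l
  proof -
    have "2 * (v \<bullet> l) \<le> (\<Sum>i\<in>UNIV. \<bar>l $ i\<bar>)"
      using circuit_bound v l lattice_subset by auto
    also have "\<dots> \<le> (\<Sum>i\<in>UNIV. l $ i * l $ i)"
    proof (rule sum_mono)
      fix i
      obtain k where k: "l $ i = of_int k" using lattice_int[OF l, of i] by (auto elim: Ints_cases)
      have "\<bar>k\<bar> * 1 \<le> \<bar>k\<bar> * \<bar>k\<bar>" by (cases "k = 0") (simp, intro mult_left_mono, auto)
      then have "\<bar>k\<bar> \<le> k * k" by simp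
      then show "\<bar>l $ i\<bar> \<le> l $ i * l $ i" unfolding k by (simp flip: of_int_abs of_int_mult)
    qed
    finally show ?thesis by (simp add: inner_vec_def)
  qed
  then show "v \<in> voronoi" using v by (auto simp: voronoi_def)
qed (auto simp: voronoi_def circuits_def)

lemma voronoi_bound: "v \<in> voronoi \<Longrightarrow> a \<in> H \<Longrightarrow> 2 * (v \<bullet> a) \<le> (\<Sum>i\<in>UNIV. \<bar>a $ i\<bar>)"
  by (rule circuit_bound) (auto simp: voronoi_eq_circuits)

text \<open>Finitely many circuit inequalities suffice. Being a polyhedron ensures that all faces
  are exposed, so that each is given by a linear functional.\<close>

lemma polyhedron_voronoi: "polyhedron voronoi"
proof -
  have "voronoi = H \<inter> \<Inter> ((\<lambda>l. {v. l \<bullet> v \<le> (l \<bullet> l) / 2}) ` circuits)"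
    by (auto simp: voronoi_eq_circuits inner_commute[of _ "_ :: real ^ 'n"] field_simps)
  moreover have "polyhedron H"
    using subspace by (intro affine_imp_polyhedron subspace_imp_affine)
  then have "polyhedron (H \<inter> \<Inter> ((\<lambda>l. {v. l \<bullet> v \<le> (l \<bullet> l) / 2}) ` circuits))"
    using finite_circuits by (intro polyhedron_Int polyhedron_Inter) (auto simp only: polyhedron_halfspace_le finite_imageI)
  ultimately show ?thesis by simp
qed

text \<open>Orthogonal projection replaces a vector of the ambient space by one of \<open>H\<close>
  that induces the same functional on \<open>H\<close>.\<close>

lemma projection:
  obtains y where "y \<in> H" "\<And>h. h \<in> H \<Longrightarrow> y \<bullet> h = x \<bullet> h"
proof -
  obtain y z where yz: "y \<in> span H" "\<And>w. w \<in> span H \<Longrightarrow> orthogonal z w" "x = y + z"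
    using orthogonal_subspace_decomp_exists[of H x] by blast
  have "y \<bullet> h = x \<bullet> h" if "h \<in> H" for h
    using yz(2)[of h] that by (simp add: yz(3) inner_add_left span_base orthogonal_def)
  moreover have "y \<in> H" using yz(1) subspace by (simp add: span_eq_iff[THEN iffD2])
  ultimately show ?thesis using that by blast
qed

text \<open>
  Half the sign vector of \<open>a\<close> maximises \<open>a\<close> on the unit cube; its projection is the point of \<open>voronoi\<close>
  that detects the sign cone of \<open>a\<close>.
\<close>

lemma voronoi_sign_point:
  obtains r where "r \<in> voronoi" "\<And>h. h \<in> H \<Longrightarrow> 2 * (r \<bullet> h) = (\<Sum>i\<in>UNIV. sgn (a $ i) * h $ i)"
proof -
  obtain r where r: "r \<in> H" "\<And>h. h \<in> H \<Longrightarrow> r \<bullet> h = (\<chi> i. sgn (a $ i) / 2) \<bullet> h"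
    using projection by blast
  have eq: "2 * (r \<bullet> h) = (\<Sum>i\<in>UNIV. sgn (a $ i) * h $ i)" if "h \<in> H" for h
    using r(2)[OF that] by (simp add: inner_vec_def sum_distrib_left)
  have "2 * (r \<bullet> l) \<le> l \<bullet> l" if l: "l \<in> circuits" for l
  proof -
    have "l \<in> H" using l lattice_subset by (auto simp: circuits_def)
    moreover have "sgn (a $ i) * l $ i \<le> l $ i * l $ i" for i
    proof -
      have "l $ i \<in> {- 1, 0, 1}" using l by (auto simp: circuits_def)
      then show ?thesis by (auto simp: sgn_if)
    qed
    ultimately show ?thesis by (simp add: eq inner_vec_def[of l l] sum_mono)
  qed
  then have "r \<in> voronoi" using r by (simp add: voronoi_eq_circuits)
  then show ?thesis using that eq by blast
qed

text \<open>Together with \<open>voronoi_bound\<close> this identifies the support function of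
  \<open>voronoi\<close> at \<open>a\<close> as half the sum of absolute values.\<close>

lemma voronoi_max:
  assumes "a \<in> H"
  obtains r where "r \<in> voronoi" "2 * (r \<bullet> a) = (\<Sum>i\<in>UNIV. \<bar>a $ i\<bar>)"
proof -
  obtain r where "r \<in> voronoi" "\<And>h. h \<in> H \<Longrightarrow> 2 * (r \<bullet> h) = (\<Sum>i\<in>UNIV. sgn (a $ i) * h $ i)"
    using voronoi_sign_point[of a] by blast
  then show ?thesis using that[of r] assms by (simp add: linordered_idom_class.abs_sgn mult.commute)
qed

section \<open>Normal cones of the Voronoi polytope\<close>

lemma normal_eq:
  assumes "\<delta> \<subseteq> voronoi"
  shows "normal \<delta> = {a \<in> H. \<forall>r\<in>\<delta>. 2 * (r \<bullet> a) = (\<Sum>i\<in>UNIV. \<bar>a $ i\<bar>)}"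
proof (intro set_eqI iffI)
  fix a assume a: "a \<in> normal \<delta>"
  then have "a \<in> H" by (simp add: normal_def)
  \<comment> \<open>Since the upper bound is attained at \<open>r'\<close>, every maximiser of
    \<open>a\<close> must attain it too.\<close>
  then obtain r' where r': "r' \<in> voronoi" "2 * (r' \<bullet> a) = (\<Sum>i\<in>UNIV. \<bar>a $ i\<bar>)"
    using voronoi_max by blast
  have "2 * (r \<bullet> a) = (\<Sum>i\<in>UNIV. \<bar>a $ i\<bar>)" if "r \<in> \<delta>" for r
  proof -
    have "a \<bullet> r' \<le> a \<bullet> r" using a r' that by (auto simp: normal_def)
    then show ?thesis
      using voronoi_bound[of r a] \<open>a \<in> H\<close> that assms r' by (auto simp: inner_commute)
  qed
  then show "a \<in> {a \<in> H. \<forall>r\<in>\<delta>. 2 * (r \<bullet> a) = (\<Sum>i\<in>UNIV. \<bar>a $ i\<bar>)}" using \<open>a \<in> H\<close> by simp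
next
  fix a assume a: "a \<in> {a \<in> H. \<forall>r\<in>\<delta>. 2 * (r \<bullet> a) = (\<Sum>i\<in>UNIV. \<bar>a $ i\<bar>)}"
  have "a \<bullet> r' \<le> a \<bullet> r" if "r \<in> \<delta>" "r' \<in> voronoi" for r r'
    using voronoi_bound[of r' a] a that by (auto simp: inner_commute)
  then show "a \<in> normal \<delta>" using a by (simp add: normal_def)
qed

text \<open>For \<open>a\<close> in \<open>H\<close> the right-hand side is twice the maximum of
  \<open>a\<close> on \<open>voronoi\<close>, so this is the face on which \<open>a\<close> is
  maximal.\<close>

definition exposed :: "real ^ 'n \<Rightarrow> (real ^ 'n) set" where
  "exposed a = {r \<in> voronoi. 2 * (r \<bullet> a) = (\<Sum>i\<in>UNIV. \<bar>a $ i\<bar>)}"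

text \<open>Testing \<open>b\<close> on the sign point of \<open>a\<close> gives equality in a sum
  of termwise inequalities, hence sign agreement in every coordinate. Conversely, \<open>a\<close>
  splits into \<open>t *\<^sub>R b\<close> and a remainder in the same sign cone, where the support
  function is additive; a point attaining the bound at \<open>a\<close> must then attain it at
  \<open>b\<close>.\<close>

lemma normal_exposed:
  assumes a: "a \<in> H"
  shows "normal (exposed a) = sign_cone H a"
proof (intro set_eqI iffI)
  fix b assume b: "b \<in> normal (exposed a)"
  obtain r where r: "r \<in> voronoi" "\<And>h. h \<in> H \<Longrightarrow> 2 * (r \<bullet> h) = (\<Sum>i\<in>UNIV. sgn (a $ i) * h $ i)"
    using voronoi_sign_point[of a] by blast
  have bH: "b \<in> H" using b by (simp add: normal_def)
  have "r \<in> exposed a" using r a by (simp add: exposed_def linordered_idom_class.abs_sgn mult.commute)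
  then have "2 * (r \<bullet> b) = (\<Sum>i\<in>UNIV. \<bar>b $ i\<bar>)"
    using b normal_eq[of "exposed a"] by (auto simp: exposed_def)
  then have "(\<Sum>i\<in>UNIV. \<bar>b $ i\<bar> - sgn (a $ i) * b $ i) = 0"
    using r(2)[OF bH] by (simp add: sum_subtractf)
  moreover have "0 \<le> \<bar>b $ i\<bar> - sgn (a $ i) * b $ i" for i by (auto simp: sgn_if abs_if)
  ultimately have "\<bar>b $ i\<bar> - sgn (a $ i) * b $ i = 0" for i
    by (simp add: sum_nonneg_eq_0_iff)
  then have "b $ i = 0 \<or> sgn (b $ i) = sgn (a $ i)" for i
    using sgn_mult_eq_abs_iff[of "a $ i" "b $ i"] by (metis eq_iff_diff_eq_0)
  then show "b \<in> sign_cone H a" using bH by (simp add: sign_cone_def)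
next
  fix b assume b: "b \<in> sign_cone H a"
  then have bH: "b \<in> H" using sign_cone_subset by blast
  obtain t where t: "0 < t" "t < 1" "a - t *\<^sub>R b \<in> sign_cone H a"
    using sign_cone_subtract[OF subspace a b] by blast
  have sum: "(\<Sum>i\<in>UNIV. \<bar>a $ i\<bar>) = (\<Sum>i\<in>UNIV. \<bar>(a - t *\<^sub>R b) $ i\<bar>) + t * (\<Sum>i\<in>UNIV. \<bar>b $ i\<bar>)"
    by (intro sum_abs_sign_cone[OF sign_cone_self[OF a] t(3) b]) simp
  have "2 * (r \<bullet> b) = (\<Sum>i\<in>UNIV. \<bar>b $ i\<bar>)" if r: "r \<in> exposed a" for r
  proof (rule antisym)
    have rV: "r \<in> voronoi" and eq: "2 * (r \<bullet> a) = (\<Sum>i\<in>UNIV. \<bar>a $ i\<bar>)" using r by (auto simp: exposed_def)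
    show "2 * (r \<bullet> b) \<le> (\<Sum>i\<in>UNIV. \<bar>b $ i\<bar>)" using voronoi_bound[OF rV bH] .
    have "2 * (r \<bullet> (a - t *\<^sub>R b)) \<le> (\<Sum>i\<in>UNIV. \<bar>(a - t *\<^sub>R b) $ i\<bar>)"
      using voronoi_bound[OF rV] t(3) sign_cone_subset by blast
    then have "t * (\<Sum>i\<in>UNIV. \<bar>b $ i\<bar>) \<le> t * (2 * (r \<bullet> b))"
      using eq sum by (simp add: inner_diff_right)
    then show "(\<Sum>i\<in>UNIV. \<bar>b $ i\<bar>) \<le> 2 * (r \<bullet> b)" using t(1) by simp
  qed
  then show "b \<in> normal (exposed a)"
    using bH normal_eq[of "exposed a"] by (auto simp: exposed_def)
qed

lemma exposed_face_of:
  assumes a: "a \<in> H"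
  shows "exposed a face_of voronoi"
proof -
  have "exposed a = voronoi \<inter> {r. a \<bullet> r = (\<Sum>i\<in>UNIV. \<bar>a $ i\<bar>) / 2}"
    by (auto simp: exposed_def inner_commute)
  moreover have "\<dots> face_of voronoi"
  proof (rule face_of_Int_supporting_hyperplane_le)
    show "convex voronoi" by (rule polyhedron_imp_convex[OF polyhedron_voronoi])
    show "a \<bullet> r \<le> (\<Sum>i\<in>UNIV. \<bar>a $ i\<bar>) / 2" if "r \<in> voronoi" for r
      using voronoi_bound[OF that a] by (simp add: inner_commute)
  qed
  ultimately show ?thesis by simp
qed

text \<open>The functional \<open>c\<close> exposing the face comes from the ambient space; its
  projection \<open>a\<close> to \<open>H\<close> takes the same values on \<open>voronoi\<close>.
  As the face is nonempty, the level \<open>b\<close> has to be the maximum of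
  \<open>a\<close>.\<close>

lemma face_eq_exposed:
  assumes "\<delta> face_of voronoi" "\<delta> \<noteq> {}"
  obtains a where "a \<in> H" "\<delta> = exposed a"
proof -
  have "\<delta> exposed_face_of voronoi" using assms exposed_face_of_polyhedron[OF polyhedron_voronoi] by blast
  then obtain c b where cb: "voronoi \<subseteq> {x. c \<bullet> x \<le> b}" "\<delta> = voronoi \<inter> {x. c \<bullet> x = b}"
    by (auto simp: exposed_face_of_def)
  obtain a where a: "a \<in> H" "\<And>h. h \<in> H \<Longrightarrow> a \<bullet> h = c \<bullet> h" using projection by blast
  have VH: "voronoi \<subseteq> H" by (auto simp: voronoi_def)
  obtain r where r: "r \<in> voronoi" "2 * (r \<bullet> a) = (\<Sum>i\<in>UNIV. \<bar>a $ i\<bar>)" using voronoi_max[OF a(1)] by blast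
  obtain d where d: "d \<in> \<delta>" using assms by blast
  have ac: "r \<bullet> a = c \<bullet> r" if "r \<in> voronoi" for r using a(2)[of r] that VH by (auto simp: inner_commute)
  have "2 * b = (\<Sum>i\<in>UNIV. \<bar>a $ i\<bar>)"
  proof (rule antisym)
    show "2 * b \<le> (\<Sum>i\<in>UNIV. \<bar>a $ i\<bar>)" using voronoi_bound[of d a] d cb ac[of d] a by auto
    show "(\<Sum>i\<in>UNIV. \<bar>a $ i\<bar>) \<le> 2 * b" using r ac[of r] cb by auto
  qed
  then have "\<delta> = exposed a" using cb ac by (auto simp: exposed_def)
  then show ?thesis using that a by blast
qed

lemma normal_fan_eq: "{normal \<delta> | \<delta>. \<delta> \<noteq> {} \<and> \<delta> face_of voronoi} = sign_cone H ` H"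
proof (intro set_eqI iffI)
  fix \<tau> assume "\<tau> \<in> {normal \<delta> | \<delta>. \<delta> \<noteq> {} \<and> \<delta> face_of voronoi}"
  then obtain \<delta> where "\<tau> = normal \<delta>" "\<delta> \<noteq> {}" "\<delta> face_of voronoi" by blast
  moreover from this obtain a where "a \<in> H" "\<delta> = exposed a" using face_eq_exposed by blast
  ultimately show "\<tau> \<in> sign_cone H ` H" using normal_exposed by simp
next
  fix \<tau> assume "\<tau> \<in> sign_cone H ` H"
  then obtain a where a: "a \<in> H" "\<tau> = sign_cone H a" by blast
  have "exposed a \<noteq> {}" using voronoi_max[OF a(1)] by (auto simp: exposed_def)
  then show "\<tau> \<in> {normal \<delta> | \<delta>. \<delta> \<noteq> {} \<and> \<delta> face_of voronoi}"
    using a normal_exposed[OF a(1)] exposed_face_of[OF a(1)] by blast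
qed

end

section \<open>The homology lattice of a graph\<close>

context finite_graph
begin

lemma subspace_H1: "subspace (H1_real G arev)"
  unfolding subspace_def H1_def
  by (auto simp: chains_def boundary_def sum.distrib sum_distrib_left[symmetric])

text \<open>The two orientations contribute equally, which cancels the factor one half in
  \<open>chain_form\<close>.\<close>

lemma chain_form_H1_edge_chain:
  assumes "v \<in> H1_real G arev" "e \<in> arcs G"
  shows "chain_form v (edge_chain arev e) = v $ e"
proof -
  have "v $ arev e = - v $ e" using assms by (auto simp: H1_def chains_def)
  then show ?thesis by (simp add: chain_form_def edge_chain_def inner_diff_right inner_axis)
qed

text \<open>Pairing with an edge chain reads off a coordinate, so the cographic hyperplanes are the
  coordinate hyperplanes. Indices outside \<open>arcs G\<close> do not interfere, because all
  homology classes vanish there.\<close>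

lemma complement_arrangement:
  "H1_real G arev - \<Union>(cographic_arrangement G arev) = generic_points (H1_real G arev)"
proof (intro set_eqI iffI)
  fix v assume v: "v \<in> H1_real G arev - \<Union>(cographic_arrangement G arev)"
  have "v $ e \<noteq> 0" if w: "w \<in> H1_real G arev" "w $ e \<noteq> 0" for w e
  proof
    assume "v $ e = 0"
    have e: "e \<in> arcs G" using w by (auto simp: H1_def chains_def)
    then have "{v \<in> H1_real G arev. chain_form v (edge_chain arev e) = 0} \<in> cographic_arrangement G arev"
      unfolding cographic_arrangement_def mem_Collect_eq
      using w chain_form_H1_edge_chain[OF w(1) e] e by (intro exI[of _ e]) (auto intro!: bexI[of _ w])
    moreover have "chain_form v (edge_chain arev e) = 0"
      using chain_form_H1_edge_chain[OF _ e] v \<open>v $ e = 0\<close> by auto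
    ultimately show False using v by blast
  qed
  then show "v \<in> generic_points (H1_real G arev)" using v by (auto simp: generic_points_def)
next
  fix v assume v: "v \<in> generic_points (H1_real G arev)"
  then have vH: "v \<in> H1_real G arev" by (simp add: generic_points_def)
  have "v \<notin> S" if S: "S \<in> cographic_arrangement G arev" for S
  proof -
    obtain e w where e: "e \<in> arcs G" "S = {v \<in> H1_real G arev. chain_form v (edge_chain arev e) = 0}"
      and w: "w \<in> H1_real G arev" "chain_form w (edge_chain arev e) \<noteq> 0"
      using S unfolding cographic_arrangement_def by blast
    have "v $ e \<noteq> 0"
      using v w chain_form_H1_edge_chain[OF w(1) e(1)] by (auto simp: generic_points_def)
    then show ?thesis using chain_form_H1_edge_chain[OF vH e(1)] by (simp add: e(2))
  qed
  then show "v \<in> H1_real G arev - \<Union>(cographic_arrangement G arev)" using vH by blast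
qed

text \<open>The heads of the arcs in \<open>C\<close> are the tails of their successors, so
  reindexing along the permutation \<open>nxt\<close> cancels heads against tails. The general
  coefficient ring yields the integral and the real class at once.\<close>

lemma H1_sum_edge_chain:
  assumes C: "C \<subseteq> arcs G" "bij_betw nxt C C" "\<And>e. e \<in> C \<Longrightarrow> tail G (nxt e) = head G e"
  shows "(\<Sum>e\<in>C. edge_chain arev e) \<in> (H1 G arev :: ('a::comm_ring_1 ^ 'e) set)"
proof -
  let ?l = "(\<Sum>e\<in>C. edge_chain arev e) :: 'a ^ 'e"
  have "?l \<in> chains G arev"
  proof -
    have "edge_chain arev e \<in> (chains G arev :: ('a ^ 'e) set)" if "e \<in> C" for e
      using edge_chain_in_chains that C by blast
    then show ?thesis
      by (auto simp: chains_def sum_negf[symmetric] intro!: sum.cong sum.neutral)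
  qed
  moreover have "boundary G ?l v = 0" for v
  proof -
    have "boundary G ?l v = (\<Sum>e\<in>C. boundary G (edge_chain arev e) v)"
      unfolding boundary_def sum_component by (rule sum.swap)
    also have "\<dots> = (\<Sum>e\<in>C. of_bool (head G e = v) - of_bool (tail G e = v))"
      using C by (intro sum.cong refl boundary_edge_chain) auto
    also have "\<dots> = (\<Sum>e\<in>C. of_bool (tail G (nxt e) = v)) - (\<Sum>e\<in>C. of_bool (tail G e = v))"
      using C(3) by (simp add: sum_subtractf)
    also have "(\<Sum>e\<in>C. of_bool (tail G (nxt e) = v)) = (\<Sum>e\<in>C. of_bool (tail G e = v) :: 'a)"
      by (rule sum.reindex_bij_betw[OF C(2)])
    finally show ?thesis by simp
  qed
  ultimately show ?thesis by (simp add: H1_def)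
qed

lemma sum_edge_chain_component:
  "(\<Sum>e\<in>C. edge_chain arev e) $ f = of_bool (f \<in> C) - (of_bool (arev f \<in> C) :: 'a::comm_ring_1)"
proof -
  have "(\<Sum>e\<in>C. edge_chain arev e) $ f
      = (\<Sum>e\<in>C. (if e = f then 1 else 0) - (if e = arev f then 1 else (0::'a)))"
    unfolding sum_component by (rule sum.cong) (auto simp: edge_chain_def axis_def)
  then show ?thesis by (simp add: sum_subtractf of_bool_def)
qed

text \<open>The coefficients of the arcs entering the head of \<open>e\<close> add up to zero, so
  the positive one at \<open>e\<close> is compensated by a negative one. Reversing that arc gives a
  positive arc leaving the head of \<open>e\<close>.\<close>

lemma H1_positive_successor:
  assumes a: "a \<in> H1_real G arev" and e: "e \<in> arcs G" "a $ e > 0"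
  obtains f where "f \<in> arcs G" "a $ f > 0" "tail G f = head G e"
proof -
  let ?I = "{f \<in> arcs G. head G f = head G e}"
  have 0: "(\<Sum>f\<in>?I. a $ f) = 0"
    using a e by (auto simp: H1_def boundary_def)
  have "\<exists>f\<in>?I. a $ f < 0"
  proof (rule ccontr)
    assume "\<not> ?thesis"
    then have "(\<Sum>f\<in>?I. a $ f) > 0"
      using e by (intro sum_pos2[of _ e]) (auto simp: not_less)
    then show False using 0 by simp
  qed
  then obtain f where f: "f \<in> arcs G" "head G f = head G e" "a $ f < 0" by blast
  have "a $ arev f = - a $ f" using a f by (auto simp: H1_def chains_def)
  then show ?thesis using that[of "arev f"] f by simp
qed

text \<open>
  Following positive arcs forward maps the set of positive arcs to itself.  On a smallest non-empty
  invariant set the map is a bijection, so this set is a disjoint union of directed cycles.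
\<close>

lemma H1_conformal_circuit:
  assumes a: "a \<in> H1_real G arev" "a \<noteq> 0"
  shows "\<exists>l\<in>H1_lattice G arev. l \<in> sign_cone (H1_real G arev) a \<and> l \<noteq> 0 \<and> (\<forall>i. l $ i \<in> {- 1, 0, 1})"
proof -
  define P where "P = {e \<in> arcs G. a $ e > 0}"
  have rev: "a $ arev e = - a $ e" for e
    using a arev_eq[of e] by (cases "e \<in> arcs G") (auto simp: H1_def chains_def)
  obtain e where "a $ e \<noteq> 0" using a by (auto simp: vec_eq_iff)
  then have "e \<in> arcs G" using a by (auto simp: H1_def chains_def)
  then have "e \<in> P \<or> arev e \<in> P" using rev[of e] \<open>a $ e \<noteq> 0\<close> by (auto simp: P_def)
  then have "P \<noteq> {}" by blast
  have "\<exists>f. f \<in> P \<and> tail G f = head G e" if "e \<in> P" for e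
    using H1_positive_successor[OF a(1)] that unfolding P_def by blast
  then obtain nxt where nxt: "\<And>e. e \<in> P \<Longrightarrow> nxt e \<in> P \<and> tail G (nxt e) = head G e" by metis
  define inv_set where "inv_set C \<longleftrightarrow> C \<subseteq> P \<and> C \<noteq> {} \<and> nxt ` C \<subseteq> C" for C
  have "inv_set P" using nxt \<open>P \<noteq> {}\<close> by (auto simp: inv_set_def)
  then obtain C where C: "inv_set C" "\<And>D. inv_set D \<Longrightarrow> card C \<le> card D"
    using ex_has_least_nat[of inv_set P card] by blast
  have CP: "C \<subseteq> P" and "C \<noteq> {}" and sub: "nxt ` C \<subseteq> C" using C by (auto simp: inv_set_def)
  \<comment> \<open>The image is invariant as well, so the minimal cardinality of \<open>C\<close>
    rules out a proper subset.\<close>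
  have "inv_set (nxt ` C)" using C(1) unfolding inv_set_def by blast
  then have "nxt ` C = C"
    using C(2) sub by (intro card_seteq) auto
  then have bij: "bij_betw nxt C C"
    by (simp add: bij_betw_def finite_surj_inj eq_card_imp_inj_on)
  have arcs: "C \<subseteq> arcs G" using CP by (auto simp: P_def)
  have tl: "tail G (nxt e) = head G e" if "e \<in> C" for e using nxt CP that by blast
  note H1 = H1_sum_edge_chain[OF arcs bij tl]
  define l where "l = ((\<Sum>e\<in>C. edge_chain arev e) :: real ^ 'e)"
  have lH: "l \<in> H1_real G arev" unfolding l_def by (rule H1)
  have li: "l $ i = of_bool (i \<in> C) - of_bool (arev i \<in> C)" for i
    unfolding l_def by (rule sum_edge_chain_component)
  have pos: "a $ i > 0" if "i \<in> C" for i using that CP by (auto simp: P_def)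
  \<comment> \<open>Hence \<open>C\<close> never contains both orientations of an edge, and no
    cancellation occurs in \<open>l\<close>.\<close>
  have neg: "a $ i < 0" if "arev i \<in> C" for i using pos[OF that] rev[of i] by simp
  \<comment> \<open>The same sum formed with integer coefficients is the required preimage of
    \<open>l\<close>.\<close>
  have "l = (\<chi> i. real_of_int ((\<Sum>e\<in>C. edge_chain arev e) $ i))"
    by (simp add: vec_eq_iff li sum_edge_chain_component del: sum_component)
  then have "l \<in> H1_lattice G arev"
    unfolding H1_lattice_def using H1 by (rule image_eqI)
  moreover have "l $ i = 0 \<or> sgn (l $ i) = sgn (a $ i)" for i
    using pos[of i] neg[of i] by (auto simp: li)
  then have "l \<in> sign_cone (H1_real G arev) a"
    unfolding sign_cone_def using lH by blast
  moreover obtain c where "c \<in> C" using \<open>C \<noteq> {}\<close> by blast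
  then have "l $ c \<noteq> 0" using pos[of c] neg[of c] by (auto simp: li)
  then have "l \<noteq> 0" by (metis zero_index)
  moreover have "l $ i \<in> {- 1, 0, 1}" for i by (auto simp: li)
  ultimately show ?thesis by blast
qed

lemma H1_lattice_subset: "H1_lattice G arev \<subseteq> H1_real G arev"
  by (force simp: H1_lattice_def H1_def chains_def boundary_def simp flip: of_int_sum)

section \<open>Transfer to the Voronoi polytope of the graph\<close>

sublocale regular_lattice "H1_real G arev" "H1_lattice G arev"
proof
  show "subspace (H1_real G arev)" by (rule subspace_H1)
  show "H1_lattice G arev \<subseteq> H1_real G arev" by (rule H1_lattice_subset)
  show "l $ i \<in> \<int>" if "l \<in> H1_lattice G arev" for l i
    using that by (auto simp: H1_lattice_def)
qed (rule H1_conformal_circuit)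

lemma Vor_eq: "Vor G arev = voronoi"
proof -
  have "chain_form v v \<le> chain_form (v - l) (v - l) \<longleftrightarrow> 2 * (v \<bullet> l) \<le> l \<bullet> l" for v l :: "real ^ 'e"
    by (simp add: chain_form_def inner_diff_left inner_diff_right inner_commute)
  then show ?thesis by (simp add: Vor_def voronoi_def)
qed

lemma normal_cone_eq: "normal_cone G arev \<delta> = normal \<delta>"
  by (simp add: normal_cone_def normal_def Vor_eq chain_form_def)

end

theorem proposition3p8:
  fixes G :: "('v, 'e::finite) pre_digraph" and arev :: "'e \<Rightarrow> 'e"
  assumes "finite_graph G arev"
  shows "cographic_fan G arev = Vor_normal_fan G arev"
proof -
  interpret finite_graph G arev by (rule assms)
  have "cographic_fan G arev = sign_cone (H1_real G arev) ` H1_real G arev"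
    unfolding cographic_fan_def cographic_chambers_def complement_arrangement
    by (rule faces_generic_chambers[OF subspace_H1])
  also have "\<dots> = Vor_normal_fan G arev"
    unfolding Vor_normal_fan_def normal_cone_eq Vor_eq normal_fan_eq ..
  finally show ?thesis .
qed

end
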